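(* For every integer $k\ge 3$, there exist infinitely many pairwise non-isomorphic $k$-graphs that are minimal asymmetric.
   Context: A $k$-graph (or $k$-uniform hypergraph) is a pair $(X,\mathscr{M})$ where $X$ is a finite set (the vertices) and $\mathscr{M}\subseteq\binom{X}{k}=\{A\subseteq X: |A|=k\}$ (the edges). An automorphism of $(X,\mathscr{M})$ is a bijection $\phi:X\to X$ such that, for every $A\subseteq X$ with $|A|=k$, $A\in\mathscr{M}$ if and only if $\phi(A)\in\mathscr{M}$. A $k$-graph is asymmetric if its only automorphism is the identity; otherwise it is symmetric. For $X'\subseteq X$, the induced subhypergraph on $X'$ is $(X',\{M\in\mathscr{M}: M\subseteq X'\})$; it is non-trivial if $1<|X'|<|X|$. A $k$-graph is minimal asymmetric if it is asymmetric and every non-trivial induced subhypergraph of it is symmetric. "Infinitely many" is understood up to isomorphism. *)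

theory Defs
  imports Main
begin

type_synonym 'a hypergraph = "'a set \<times> 'a set set"

abbreviation verts :: "'a hypergraph \<Rightarrow> 'a set" where
  "verts G \<equiv> fst G"

abbreviation edges :: "'a hypergraph \<Rightarrow> 'a set set" where
  "edges G \<equiv> snd G"

definition kgraph :: "nat \<Rightarrow> 'a hypergraph \<Rightarrow> bool" where
  "kgraph k G \<longleftrightarrow> finite (verts G) \<and> edges G \<subseteq> {A. A \<subseteq> verts G \<and> card A = k}"

text \<open>
  Morphisms are total functions whose values outside the vertex set are irrelevant; consequently
  being the identity is only demanded on the vertex set.
\<close>

definition isomorphism :: "nat \<Rightarrow> 'a hypergraph \<Rightarrow> 'b hypergraph \<Rightarrow> ('a \<Rightarrow> 'b) \<Rightarrow> bool" where
  "isomorphism k G H \<phi> \<longleftrightarrow>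
     bij_betw \<phi> (verts G) (verts H) \<and>
     (\<forall>A. A \<subseteq> verts G \<and> card A = k \<longrightarrow> (A \<in> edges G \<longleftrightarrow> \<phi> ` A \<in> edges H))"

definition isomorphic :: "nat \<Rightarrow> 'a hypergraph \<Rightarrow> 'b hypergraph \<Rightarrow> bool" where
  "isomorphic k G H \<longleftrightarrow> (\<exists>\<phi>. isomorphism k G H \<phi>)"

definition automorphism :: "nat \<Rightarrow> 'a hypergraph \<Rightarrow> ('a \<Rightarrow> 'a) \<Rightarrow> bool" where
  "automorphism k G \<phi> \<longleftrightarrow> isomorphism k G G \<phi>"

definition asymmetric :: "nat \<Rightarrow> 'a hypergraph \<Rightarrow> bool" where
  "asymmetric k G \<longleftrightarrow> (\<forall>\<phi>. automorphism k G \<phi> \<longrightarrow> (\<forall>x \<in> verts G. \<phi> x = x))"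

abbreviation symmetric :: "nat \<Rightarrow> 'a hypergraph \<Rightarrow> bool" where
  "symmetric k G \<equiv> \<not> asymmetric k G"

definition induced :: "'a hypergraph \<Rightarrow> 'a set \<Rightarrow> 'a hypergraph" where
  "induced G X' = (X', {M \<in> edges G. M \<subseteq> X'})"

definition minimal_asymmetric :: "nat \<Rightarrow> 'a hypergraph \<Rightarrow> bool" where
  "minimal_asymmetric k G \<longleftrightarrow>
     asymmetric k G \<and>
     (\<forall>X'. X' \<subseteq> verts G \<and> 1 < card X' \<and> card X' < card (verts G) \<longrightarrow>
        symmetric k (induced G X'))"

end

theory Submission
  imports Defs "HOL-Combinatorics.Transposition"
begin

text \<open>
  Uniformity 3 carries the infinite family; a construction that adds one vertex then passes from
  \<open>k\<close> to \<open>k + 1\<close>.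

  For \<open>m \<ge> 2\<close> take the loose path with edges \<open>{2i, 2i+1, 2i+2}\<close>, \<open>i \<le> m\<close>, and add the chord
  \<open>{0, 2m, 2m+1}\<close> from its first vertex to its last edge. The chord and the last edge are the only
  two edges that share two vertices, so an automorphism preserves the pair \<open>{2m, 2m+1}\<close>. How the
  other edges meet this part fixes \<open>2m\<close>, \<open>2m+1\<close> and \<open>0\<close>; from \<open>0\<close> on, the path is fixed edge by
  edge, because in each path edge before the last one the middle vertex lies on no other edge while
  the far vertex does (\<open>asymmetric_chorded_path\<close>).
  Deleting vertices always creates a symmetry as long as two remain. If no edge survives, any two
  vertices can be exchanged. When the closed walk along the path and the chord is
  broken, a path edge next to the break, or the pair \<open>{2m, 2m+1}\<close>, has two vertices that lie on the
  same surviving edges, and exchanging such twins is an automorphism. The only proper vertex subset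
  that leaves this closed walk intact omits just \<open>2m+2\<close>, and then the walk can be reversed. Hence
  these 3-graphs, on \<open>2m+3\<close> vertices, are minimal asymmetric
  (\<open>minimal_asymmetric_chorded_path\<close>).

  To raise the uniformity, add a new vertex, the apex, to every edge. An induced subhypergraph that
  avoids the apex has no edges, and one that contains it inherits the symmetries of the
  subhypergraph below it. The cone is therefore minimal asymmetric as soon as automorphisms fix the
  apex, which holds if no vertex lies on all edges of the original. The cone itself violates that
  condition, since its apex lies on all its edges. Complementation repairs this: it preserves all
  automorphisms, hence minimal asymmetry, and in the complement of the cone no vertex lies on all
  edges once there are enough vertices (\<open>raise_uniformity\<close>). Members of the resulting family for
  different \<open>m\<close> have different numbers of vertices, so they are not isomorphic.
\<close>

section \<open>Automorphisms, twins and complements\<close>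

lemma automorphism_bij:
  assumes "automorphism k G \<phi>"
  shows "bij_betw \<phi> (verts G) (verts G)"
  using assms by (simp add: automorphism_def isomorphism_def)

lemma automorphism_edge_iff:
  assumes "automorphism k G \<phi>" "A \<subseteq> verts G" "card A = k"
  shows "\<phi> ` A \<in> edges G \<longleftrightarrow> A \<in> edges G"
  using assms by (simp add: automorphism_def isomorphism_def)

lemma automorphismI:
  assumes "bij_betw \<phi> (verts G) (verts G)"
    and "\<And>A. A \<subseteq> verts G \<Longrightarrow> card A = k \<Longrightarrow> A \<in> edges G \<longleftrightarrow> \<phi> ` A \<in> edges G"
  shows "automorphism k G \<phi>"
  using assms by (simp add: automorphism_def isomorphism_def)

lemma symmetricI:
  assumes "automorphism k G \<phi>" "x \<in> verts G" "\<phi> x \<noteq> x"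
  shows "symmetric k G"
  using assms by (auto simp: asymmetric_def)

text \<open>
  Transposing two twins preserves each edge. A set containing exactly one of the twins is not an
  edge, and neither is its image, which contains exactly the other one.
\<close>

lemma twins_symmetric:
  assumes "u \<in> verts G" "w \<in> verts G" "u \<noteq> w"
    and twins: "\<And>M. M \<in> edges G \<Longrightarrow> u \<in> M \<longleftrightarrow> w \<in> M"
  shows "symmetric k G"
proof (rule symmetricI)
  let ?t = "transpose u w"
  show "automorphism k G ?t"
  proof (rule automorphismI)
    show "bij_betw ?t (verts G) (verts G)"
      using assms by (simp add: bij_betw_transpose_iff)
    fix A
    show "A \<in> edges G \<longleftrightarrow> ?t ` A \<in> edges G"
    proof (cases "u \<in> A \<longleftrightarrow> w \<in> A")
      case True
      then show ?thesis by (simp add: transpose_image_eq)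
    next
      case False
      have "u \<in> ?t ` A \<longleftrightarrow> w \<in> A" "w \<in> ?t ` A \<longleftrightarrow> u \<in> A"
        by (simp_all add: in_transpose_image_iff)
      with False twins show ?thesis by blast
    qed
  qed
  show "u \<in> verts G" by fact
  show "?t u \<noteq> u" using \<open>u \<noteq> w\<close> by simp
qed

lemma edgeless_symmetric:
  assumes "edges G = {}" "1 < card (verts G)"
  shows "symmetric k G"
proof -
  obtain u w where "u \<in> verts G" "w \<in> verts G" "u \<noteq> w"
    using card_le_Suc0_iff_eq[OF card_ge_0_finite, of "verts G"] assms(2) by force
  then show ?thesis using assms(1) by (intro twins_symmetric[of u G w]) auto
qed

lemma verts_induced [simp]: "verts (induced G X) = X"
  and edges_induced: "edges (induced G X) = {M \<in> edges G. M \<subseteq> X}"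
  by (simp_all add: induced_def)

definition complement :: "nat \<Rightarrow> 'a hypergraph \<Rightarrow> 'a hypergraph" where
  "complement k G = (verts G, {A. A \<subseteq> verts G \<and> card A = k \<and> A \<notin> edges G})"

lemma verts_complement [simp]: "verts (complement k G) = verts G"
  and edges_complement:
    "A \<in> edges (complement k G) \<longleftrightarrow> A \<subseteq> verts G \<and> card A = k \<and> A \<notin> edges G"
  by (simp_all add: complement_def)

text \<open>
  A bijection of the vertices permutes the sets of size \<open>k\<close>, so preserving edges is the same as
  preserving non-edges.
\<close>

lemma automorphism_complement:
  "automorphism k (complement k G) \<phi> \<longleftrightarrow> automorphism k G \<phi>"
proof (cases "bij_betw \<phi> (verts G) (verts G)")
  case True
  have "A \<in> edges (complement k G) \<longleftrightarrow> A \<notin> edges G"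
    "\<phi> ` A \<in> edges (complement k G) \<longleftrightarrow> \<phi> ` A \<notin> edges G"
    if "A \<subseteq> verts G" "card A = k" for A
  proof -
    have "inj_on \<phi> A" "\<phi> ` A \<subseteq> verts G"
      using True that by (auto simp: bij_betw_def inj_on_subset)
    then show "A \<in> edges (complement k G) \<longleftrightarrow> A \<notin> edges G"
      "\<phi> ` A \<in> edges (complement k G) \<longleftrightarrow> \<phi> ` A \<notin> edges G"
      using that by (simp_all add: edges_complement card_image)
  qed
  then show ?thesis by (simp add: automorphism_def isomorphism_def cong: conj_cong)
qed (simp add: automorphism_def isomorphism_def)

lemma asymmetric_complement: "asymmetric k (complement k G) \<longleftrightarrow> asymmetric k G"
  by (simp add: asymmetric_def automorphism_complement)

lemma induced_complement:
  assumes "X \<subseteq> verts G"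
  shows "induced (complement k G) X = complement k (induced G X)"
  using assms by (auto simp: induced_def complement_def)

lemma minimal_asymmetric_complement:
  "minimal_asymmetric k G \<Longrightarrow> minimal_asymmetric k (complement k G)"
  by (simp add: minimal_asymmetric_def asymmetric_complement induced_complement)

section \<open>Raising the uniformity\<close>

definition cone :: "'a \<Rightarrow> 'a hypergraph \<Rightarrow> 'a hypergraph" where
  "cone v G = (insert v (verts G), insert v ` edges G)"

lemma verts_cone [simp]: "verts (cone v G) = insert v (verts G)"
  and edges_cone [simp]: "edges (cone v G) = insert v ` edges G"
  by (simp_all add: cone_def)

lemma insert_in_edges_cone:
  assumes "kgraph k G" "v \<notin> verts G" "v \<notin> A"
  shows "insert v A \<in> edges (cone v G) \<longleftrightarrow> A \<in> edges G"
proof -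
  have "v \<notin> M" if "M \<in> edges G" for M
    using assms that by (auto simp: kgraph_def)
  then show ?thesis using assms(3) by (auto simp: insert_ident)
qed

lemma kgraph_cone:
  assumes "kgraph k G" "v \<notin> verts G"
  shows "kgraph (Suc k) (cone v G)"
proof -
  have "card (insert v M) = Suc k" if "M \<in> edges G" for M
  proof -
    have "finite M" "v \<notin> M" "card M = k"
      using assms that by (auto simp: kgraph_def finite_subset)
    then show ?thesis by simp
  qed
  then show ?thesis using assms by (auto simp: kgraph_def)
qed

lemma kgraph_induced:
  "kgraph k G \<Longrightarrow> X \<subseteq> verts G \<Longrightarrow> kgraph k (induced G X)"
  by (auto simp: kgraph_def edges_induced finite_subset)

lemma induced_cone:
  assumes "kgraph k G" "v \<notin> verts G" "Y \<subseteq> verts G"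
  shows "induced (cone v G) (insert v Y) = cone v (induced G Y)"
proof -
  have "v \<notin> M" if "M \<in> edges G" for M
    using assms that by (auto simp: kgraph_def)
  then show ?thesis by (auto simp: induced_def cone_def)
qed

lemma automorphism_cone_iff:
  assumes G: "kgraph k G" and v: "v \<notin> verts G" and fix_v: "\<phi> v = v"
  shows "automorphism (Suc k) (cone v G) \<phi> \<longleftrightarrow> automorphism k G \<phi>"
proof
  assume aut: "automorphism (Suc k) (cone v G) \<phi>"
  have bij: "bij_betw \<phi> (verts G) (verts G)"
    using automorphism_bij[OF aut] fix_v v notIn_Un_bij_betw3[of v "verts G" \<phi> "verts G"] by simp
  show "automorphism k G \<phi>"
  proof (rule automorphismI[OF bij])
    fix A assume A: "A \<subseteq> verts G" "card A = k"
    then have "finite A" "v \<notin> A" "v \<notin> \<phi> ` A"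
      using G v bij by (auto simp: kgraph_def bij_betw_def finite_subset)
    moreover have "insert v (\<phi> ` A) \<in> edges (cone v G) \<longleftrightarrow> insert v A \<in> edges (cone v G)"
      using automorphism_edge_iff[OF aut, of "insert v A"] A \<open>finite A\<close> \<open>v \<notin> A\<close> fix_v by auto
    ultimately show "A \<in> edges G \<longleftrightarrow> \<phi> ` A \<in> edges G"
      by (simp add: insert_in_edges_cone[OF G v] del: edges_cone)
  qed
next
  assume aut: "automorphism k G \<phi>"
  have bijG: "bij_betw \<phi> (verts G) (verts G)" by (rule automorphism_bij[OF aut])
  then have bij: "bij_betw \<phi> (verts (cone v G)) (verts (cone v G))"
    using fix_v v notIn_Un_bij_betw3[of v "verts G" \<phi> "verts G"] by simp
  show "automorphism (Suc k) (cone v G) \<phi>"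
  proof (rule automorphismI[OF bij])
    fix A assume A: "A \<subseteq> verts (cone v G)" "card A = Suc k"
    show "A \<in> edges (cone v G) \<longleftrightarrow> \<phi> ` A \<in> edges (cone v G)"
    proof (cases "v \<in> A")
      case True
      define B where "B = A - {v}"
      have B: "A = insert v B" "v \<notin> B" "B \<subseteq> verts G" "card B = k"
        using True A by (auto simp: B_def)
      have "v \<notin> \<phi> ` B" using B v bijG by (auto simp: bij_betw_def)
      then have "\<phi> ` A \<in> edges (cone v G) \<longleftrightarrow> \<phi> ` B \<in> edges G"
        using insert_in_edges_cone[OF G v, of "\<phi> ` B"] B fix_v by simp
      then show ?thesis
        using insert_in_edges_cone[OF G v, of B] B automorphism_edge_iff[OF aut, of B] by simp
    next
      case False
      then have "A \<subseteq> verts G" using A by auto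
      then have "v \<notin> \<phi> ` A" using v bijG by (auto simp: bij_betw_def)
      with False show ?thesis by auto
    qed
  qed
qed

text \<open>
  The apex lies on every edge of the cone, and automorphisms permute the edges, so the image of the
  apex lies on every edge as well. Under the assumption on \<open>G\<close> the apex is the only such vertex.
\<close>

lemma apex_fixed:
  assumes G: "kgraph k G" and v: "v \<notin> verts G"
    and no_common: "\<forall>w \<in> verts G. \<exists>M \<in> edges G. w \<notin> M"
    and aut: "automorphism (Suc k) (cone v G) \<phi>"
  shows "\<phi> v = v"
proof (rule ccontr)
  assume "\<phi> v \<noteq> v"
  have bij: "bij_betw \<phi> (insert v (verts G)) (insert v (verts G))"
    using automorphism_bij[OF aut] by simp
  with \<open>\<phi> v \<noteq> v\<close> have "\<phi> v \<in> verts G" by (auto simp: bij_betw_def)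
  then obtain M where M: "M \<in> edges G" "\<phi> v \<notin> M" using no_common by blast
  let ?M = "insert v M"
  have M': "?M \<in> edges (cone v G)" using M by simp
  have "?M \<subseteq> \<phi> ` insert v (verts G)" "card ?M = Suc k"
    using kgraph_cone[OF G v] M' bij by (auto simp: kgraph_def bij_betw_def)
  then obtain A where A: "A \<subseteq> insert v (verts G)" "?M = \<phi> ` A"
    by (meson subset_imageE)
  then have "card A = Suc k"
    using \<open>card ?M = Suc k\<close> card_image[OF inj_on_subset[OF bij_betw_imp_inj_on[OF bij] A(1)]]
    by simp
  then have "A \<in> edges (cone v G)"
    using automorphism_edge_iff[OF aut, of A] A M' by simp
  then have "\<phi> v \<in> ?M" using A by auto
  with M \<open>\<phi> v \<noteq> v\<close> show False by auto
qed

text \<open>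
  An induced subhypergraph of the cone is either edgeless or the cone over an induced subhypergraph
  of \<open>G\<close> with the same apex, and in the second case automorphisms extend by fixing the apex. A
  subset consisting of the apex and one further vertex is the exception, as minimality of \<open>G\<close> says
  nothing about single vertices; since \<open>k \<ge> 2\<close>, it is too small to contain an edge.
\<close>

lemma minimal_asymmetric_cone:
  assumes G: "kgraph k G" and v: "v \<notin> verts G" and k: "2 \<le> k"
    and no_common: "\<forall>w \<in> verts G. \<exists>M \<in> edges G. w \<notin> M"
    and min: "minimal_asymmetric k G"
  shows "minimal_asymmetric (Suc k) (cone v G)"
  unfolding minimal_asymmetric_def
proof (intro conjI allI impI)
  show "asymmetric (Suc k) (cone v G)"
    unfolding asymmetric_def
  proof (intro allI impI ballI)
    fix \<phi> x assume aut: "automorphism (Suc k) (cone v G) \<phi>" and x: "x \<in> verts (cone v G)"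
    have "\<phi> v = v" by (rule apex_fixed[OF G v no_common aut])
    moreover from this have "automorphism k G \<phi>"
      using automorphism_cone_iff[OF G v] aut by blast
    ultimately show "\<phi> x = x" using min x by (auto simp: minimal_asymmetric_def asymmetric_def)
  qed
next
  fix X assume X: "X \<subseteq> verts (cone v G) \<and> 1 < card X \<and> card X < card (verts (cone v G))"
  have fin: "finite X" using X by (meson card_ge_0_finite less_trans zero_less_one)
  show "symmetric (Suc k) (induced (cone v G) X)"
  proof (cases "v \<in> X \<and> card X \<noteq> 2")
    case False
    have "\<not> M \<subseteq> X" if M: "M \<in> edges (cone v G)" for M
    proof
      assume "M \<subseteq> X"
      moreover have "v \<in> M" using M by auto
      moreover have "card M = Suc k" using kgraph_cone[OF G v] M by (auto simp: kgraph_def)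
      ultimately show False
        using False k card_mono[OF fin, of M] by auto
    qed
    then show ?thesis
      using X by (intro edgeless_symmetric) (auto simp: edges_induced)
  next
    case True
    define Y where "Y = X - {v}"
    have Y: "X = insert v Y" "v \<notin> Y" "Y \<subseteq> verts G" using True X by (auto simp: Y_def)
    have "card X = Suc (card Y)" using fin Y by simp
    moreover have "card (verts (cone v G)) = Suc (card (verts G))"
      using G v by (simp add: kgraph_def)
    ultimately have "1 < card Y" "card Y < card (verts G)" using X True by auto
    then have "symmetric k (induced G Y)" using min Y by (simp add: minimal_asymmetric_def)
    then obtain \<phi> x where \<phi>: "automorphism k (induced G Y) \<phi>" "x \<in> Y" "\<phi> x \<noteq> x"
      by (auto simp: asymmetric_def)
    (* Outside Y the value of phi is arbitrary, so the apex has to be fixed explicitly. *)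
    let ?\<psi> = "\<phi>(v := v)"
    have *: "?\<psi> y = \<phi> y" if "y \<in> Y" for y using that Y by auto
    then have "?\<psi> ` A = \<phi> ` A" if "A \<subseteq> Y" for A using that by (meson image_cong subsetD)
    then have "automorphism k (induced G Y) ?\<psi>"
      using \<phi>(1) bij_betw_cong[of Y ?\<psi> \<phi> Y, OF *]
      by (simp add: automorphism_def isomorphism_def del: fun_upd_apply)
    then have "automorphism (Suc k) (cone v (induced G Y)) ?\<psi>"
      using automorphism_cone_iff[OF kgraph_induced[OF G Y(3)], of v ?\<psi>] Y by simp
    then show ?thesis
      unfolding Y(1) induced_cone[OF G v Y(3)]
      by (rule symmetricI[of _ _ _ x]) (use \<phi> Y in auto)
  qed
qed

text \<open>
  Complementing after the cone makes the step repeatable. All sets of \<open>k + 1\<close> old vertices are edges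
  of the complement, since they avoid the apex; with \<open>k + 2 \<le> N\<close> some such set avoids any given
  vertex. Labelling the apex by the next number keeps the vertex set an initial segment.
\<close>

lemma raise_uniformity:
  fixes G :: "nat hypergraph"
  assumes G: "kgraph k G" "verts G = {..<N}" and k: "2 \<le> k" "k + 2 \<le> N"
    and no_common: "\<forall>w \<in> verts G. \<exists>M \<in> edges G. w \<notin> M"
    and min: "minimal_asymmetric k G"
  obtains H :: "nat hypergraph" where "kgraph (Suc k) H" "verts H = {..<Suc N}"
    "\<forall>w \<in> verts H. \<exists>M \<in> edges H. w \<notin> M" "minimal_asymmetric (Suc k) H"
proof
  let ?C = "cone N G"
  let ?H = "complement (Suc k) ?C"
  have N: "N \<notin> verts G" using G by simp
  show "kgraph (Suc k) ?H"
    using kgraph_cone[OF G(1) N] by (auto simp: kgraph_def edges_complement)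
  show "verts ?H = {..<Suc N}" using G by (simp add: lessThan_Suc)
  show "minimal_asymmetric (Suc k) ?H"
    by (intro minimal_asymmetric_complement minimal_asymmetric_cone) (use assms N in auto)
  show "\<forall>w \<in> verts ?H. \<exists>M \<in> edges ?H. w \<notin> M"
  proof
    fix w
    have "Suc k \<le> card ({..<N} - {w})" using k by (auto simp: card_Diff_singleton_if)
    then obtain M where "M \<subseteq> {..<N} - {w}" "card M = Suc k" by (meson obtain_subset_with_card_n)
    then have "M \<in> edges ?H" "w \<notin> M" using G by (auto simp: edges_complement)
    then show "\<exists>M \<in> edges ?H. w \<notin> M" by blast
  qed
qed

section \<open>Minimal asymmetric 3-graphs: a loose path closed by a chord\<close>

definition link :: "nat \<Rightarrow> nat set" where
  "link i = {2 * i..2 * i + 2}"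

definition chord :: "nat \<Rightarrow> nat set" where
  "chord m = {0, 2 * m, 2 * m + 1}"

definition chorded_path :: "nat \<Rightarrow> nat hypergraph" where
  "chorded_path m = ({..2 * m + 2}, insert (chord m) (link ` {..m}))"

lemma verts_chorded_path [simp]: "verts (chorded_path m) = {..2 * m + 2}"
  and edges_chorded_path: "edges (chorded_path m) = insert (chord m) (link ` {..m})"
  by (simp_all add: chorded_path_def)

lemma mem_link: "x \<in> link i \<longleftrightarrow> 2 * i \<le> x \<and> x \<le> 2 * i + 2"
  by (simp add: link_def)

lemma mem_chord: "x \<in> chord m \<longleftrightarrow> x = 0 \<or> x = 2 * m \<or> x = 2 * m + 1"
  by (auto simp: chord_def)

lemma link_eq: "link i = {2 * i, 2 * i + 1, 2 * i + 2}"
  by (auto simp: mem_link)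

lemma link_in_edges: "i \<le> m \<Longrightarrow> link i \<in> edges (chorded_path m)"
  and chord_in_edges: "chord m \<in> edges (chorded_path m)"
  by (auto simp: edges_chorded_path)

lemma kgraph_chorded_path: 
  assumes "0 < m" shows "kgraph 3 (chorded_path m)"
  using assms by (auto simp: kgraph_def edges_chorded_path mem_link mem_chord chord_def link_def)

lemma chorded_path_no_common_vertex:
  assumes "2 \<le> m"
  shows "\<forall>w \<in> verts (chorded_path m). \<exists>M \<in> edges (chorded_path m). w \<notin> M"
proof
  fix w
  have "w \<notin> link 0 \<or> w \<notin> link m" using assms by (auto simp: mem_link)
  then show "\<exists>M \<in> edges (chorded_path m). w \<notin> M"
    using link_in_edges[of 0 m] link_in_edges[of m m] by auto
qed

lemma chorded_path_edge_iff:
  "M \<in> edges (chorded_path m) \<longleftrightarrow> M = chord m \<or> (\<exists>i\<le>m. M = link i)"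
  by (auto simp: edges_chorded_path)

lemma chorded_path_edgeE:
  assumes "M \<in> edges (chorded_path m)"
  obtains "M = chord m" | i where "i \<le> m" "M = link i"
  using assms by (auto simp: edges_chorded_path)

lemma edge_mem_pair:
  assumes "M \<in> edges (chorded_path m)" "2 * m + 1 \<in> M"
  shows "2 * m \<in> M"
  using assms by (auto simp: chorded_path_edge_iff mem_link mem_chord)

lemma last_vertex_edge:
  assumes "M \<in> edges (chorded_path m)" "2 * m + 2 \<in> M"
  shows "M = link m"
  using assms by (auto simp: chorded_path_edge_iff mem_link mem_chord)

lemma chord_neq_link: "2 \<le> m \<Longrightarrow> i \<le> m \<Longrightarrow> chord m \<noteq> link i"
  using mem_chord[of 0 m] mem_chord[of "2 * m" m] mem_link[of 0 i] mem_link[of "2 * m" i] by fastforce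

text \<open>
  This property recognizes the closing part of the path inside the 3-graph. It needs \<open>m \<ge> 2\<close>: for
  \<open>m = 1\<close> the chord also shares \<open>0\<close> and \<open>2\<close> with \<open>link 0\<close>.
\<close>

lemma edges_sharing_two_vertices:
  assumes m: "2 \<le> m" and M: "M \<in> edges (chorded_path m)" "M' \<in> edges (chorded_path m)" "M \<noteq> M'"
    and xy: "x \<noteq> y" "x \<in> M" "y \<in> M" "x \<in> M'" "y \<in> M'"
  shows "{M, M'} = {chord m, link m}"
proof -
  have links: "i = j" if "x \<in> link i" "y \<in> link i" "x \<in> link j" "y \<in> link j" for i j
    using that \<open>x \<noteq> y\<close> unfolding mem_link by linarith
  have chord: "i = m" if "x \<in> link i" "y \<in> link i" "x \<in> chord m" "y \<in> chord m" "i \<le> m" for i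
    using that \<open>x \<noteq> y\<close> m unfolding mem_link mem_chord by linarith
  show ?thesis
    using M(1,2)
  proof (elim chorded_path_edgeE)
    fix i j assume "M = link i" "M' = link j"
    then show ?thesis using links[of i j] M(3) xy by simp
  next
    fix i assume "M = chord m" "M' = link i" "i \<le> m"
    then show ?thesis using chord[of i] xy by simp
  next
    fix i assume "M = link i" "M' = chord m" "i \<le> m"
    then show ?thesis using chord[of i] xy by auto
  qed (use M in simp)
qed

text \<open>
  Automorphisms map edges injectively to edges. Once the vertices of the chord are known to be fixed,
  rigidity spreads from \<open>0\<close> along the path: if all vertices up to \<open>2i\<close> are fixed, \<open>link i\<close> can only
  be mapped to itself, and the following path edge tells its two remaining vertices apart.
\<close>

lemma asymmetric_chorded_path:
  assumes m: "2 \<le> m"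
  shows "asymmetric 3 (chorded_path m)"
  unfolding asymmetric_def
proof (intro allI impI)
  fix \<phi> assume aut: "automorphism 3 (chorded_path m) \<phi>"
  have inj: "inj_on \<phi> {..2 * m + 2}"
    using automorphism_bij[OF aut] by (simp add: bij_betw_def)
  have inj': "\<phi> x = \<phi> y \<longleftrightarrow> x = y" if "x \<le> 2 * m + 2" "y \<le> 2 * m + 2" for x y
    using inj_on_eq_iff[OF inj, of x y] that by simp
  have edge_props: "M \<subseteq> verts (chorded_path m)" "card M = 3" if "M \<in> edges (chorded_path m)" for M
    using kgraph_chorded_path[of m] m that unfolding kgraph_def by auto
  have sub: "M \<subseteq> {..2 * m + 2}" if "M \<in> edges (chorded_path m)" for M
    using edge_props[OF that] by simp
  have edge: "\<phi> ` M \<in> edges (chorded_path m)" if "M \<in> edges (chorded_path m)" for M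
    using automorphism_edge_iff[OF aut edge_props[OF that]] that by simp
  have edge_cases: "\<phi> ` M = chord m \<or> (\<exists>i\<le>m. \<phi> ` M = link i)"
    if "M \<in> edges (chorded_path m)" for M
    using edge[OF that] unfolding chorded_path_edge_iff .
  have inj_edges: "\<phi> ` M = \<phi> ` M' \<longleftrightarrow> M = M'"
    if "M \<in> edges (chorded_path m)" "M' \<in> edges (chorded_path m)" for M M'
    by (rule inj_on_image_eq_iff[OF inj sub[OF that(1)] sub[OF that(2)]])
  have mem_image: "\<phi> x \<in> \<phi> ` M \<longleftrightarrow> x \<in> M" if "x \<le> 2 * m + 2" "M \<in> edges (chorded_path m)" for x M
    using inj_on_image_mem_iff[OF inj, of x M] sub[OF that(2)] that(1) by simp

  have last_two: "chord m \<in> edges (chorded_path m)" "link m \<in> edges (chorded_path m)"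
    by (simp_all add: chord_in_edges link_in_edges)
  have inter: "chord m \<inter> link m = {2 * m, 2 * m + 1}"
    using m by (auto simp: mem_link mem_chord)
  have "\<phi> ` chord m \<noteq> \<phi> ` link m"
    using inj_edges[OF last_two] chord_neq_link[of m m] m by simp
  moreover have "\<phi> (2 * m) \<noteq> \<phi> (2 * m + 1)" using inj'[of "2 * m" "2 * m + 1"] by simp
  ultimately have images: "{\<phi> ` chord m, \<phi> ` link m} = {chord m, link m}"
    by (rule edges_sharing_two_vertices[OF m edge[OF last_two(1)] edge[OF last_two(2)]])
      (simp_all add: mem_chord mem_link)
  have "\<phi> ` (chord m \<inter> link m) = \<phi> ` chord m \<inter> \<phi> ` link m"
    by (rule inj_on_image_Int[OF inj sub[OF last_two(1)] sub[OF last_two(2)]])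
  also have "\<dots> = chord m \<inter> link m"
    using images by (auto simp: doubleton_eq_iff)
  finally have pair: "{\<phi> (2 * m), \<phi> (2 * m + 1)} = {2 * m, 2 * m + 1}"
    by (simp add: inter)
  have ends: "\<phi> ` chord m = chord m \<or> \<phi> ` chord m = link m"
    using images by (auto simp: doubleton_eq_iff)

  (* Exchanging 2m and 2m+1 would give an edge on 2m+1 but not on 2m: the image of link (m - 1). *)
  have fix_b: "\<phi> (2 * m) = 2 * m"
  proof (rule ccontr)
    assume "\<phi> (2 * m) \<noteq> 2 * m"
    then have swap: "\<phi> (2 * m) = 2 * m + 1" "\<phi> (2 * m + 1) = 2 * m"
      using pair by (simp_all add: doubleton_eq_iff)
    have e: "link (m - 1) \<in> edges (chorded_path m)" by (rule link_in_edges) simp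
    have "2 * m \<in> link (m - 1)" "2 * m + 1 \<notin> link (m - 1)" using m by (auto simp: mem_link)
    then have "2 * m + 1 \<in> \<phi> ` link (m - 1)" "2 * m \<notin> \<phi> ` link (m - 1)"
      using mem_image[OF _ e, of "2 * m"] mem_image[OF _ e, of "2 * m + 1"] swap by simp_all
    then show False
      using edge_mem_pair[OF edge[OF e]] by blast
  qed
  have fix_d: "\<phi> (2 * m + 1) = 2 * m + 1" using pair fix_b by (simp add: doubleton_eq_iff)
  (* Only 0 and 2m+2 can complete the pair {2m, 2m+1} to an edge, and the only edge on 2m+2 also
     contains the fixed vertex 2m+1, whereas link 0 does not. *)
  have fix_a: "\<phi> 0 = 0"
  proof (rule ccontr)
    assume "\<phi> 0 \<noteq> 0"
    have e: "link 0 \<in> edges (chorded_path m)" by (rule link_in_edges) simp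
    have "\<phi> 0 \<in> \<phi> ` chord m" by (simp add: mem_chord)
    then have "\<phi> 0 \<in> chord m \<or> \<phi> 0 \<in> link m" using ends by blast
    moreover have "\<phi> 0 \<noteq> 2 * m" "\<phi> 0 \<noteq> 2 * m + 1"
      using inj'[of 0 "2 * m"] inj'[of 0 "2 * m + 1"] fix_b fix_d m by auto
    ultimately have c: "\<phi> 0 = 2 * m + 2" using \<open>\<phi> 0 \<noteq> 0\<close> by (auto simp: mem_chord mem_link)
    have "2 * m + 2 \<in> \<phi> ` link 0" using mem_image[OF _ e, of 0] c by (simp add: mem_link)
    then have "\<phi> ` link 0 = link m"
      by (rule last_vertex_edge[OF edge[OF e]])
    then have "\<phi> (2 * m + 1) \<in> \<phi> ` link 0" using fix_d by (simp add: mem_link)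
    then show False using mem_image[OF _ e, of "2 * m + 1"] m by (simp add: mem_link)
  qed

  have along: "\<forall>x \<le> 2 * i. \<phi> x = x" if "i \<le> m" for i
    using that
  proof (induction i)
    case 0
    show ?case using fix_a by simp
  next
    case (Suc i)
    have IH: "\<phi> x = x" if "x \<le> 2 * i" for x using that Suc by simp
    have i: "i < m" using Suc by simp
    have e: "link i \<in> edges (chorded_path m)" and e': "link (Suc i) \<in> edges (chorded_path m)"
      using i by (auto intro: link_in_edges)
    have avoids: "\<phi> (2 * i + 1) \<noteq> x" if "x \<le> 2 * m + 2" "\<phi> x = x" "x \<noteq> 2 * i + 1" for x
      using inj'[of "2 * i + 1" x] i that by simp
    have new: "2 * i < \<phi> (2 * i + 1)" "\<phi> (2 * i + 1) \<notin> chord m"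
    proof -
      have "\<phi> (2 * i + 1) \<noteq> x" if "x \<le> 2 * i" for x using avoids[of x] IH[OF that] i that by simp
      then show "2 * i < \<phi> (2 * i + 1)" using not_le by blast
      show "\<phi> (2 * i + 1) \<notin> chord m"
        using avoids[of 0] avoids[of "2 * m"] avoids[of "2 * m + 1"] fix_a fix_b fix_d i
        by (auto simp: mem_chord)
    qed
    have "2 * i \<in> \<phi> ` link i" using mem_image[OF _ e, of "2 * i"] IH[of "2 * i"] i by (simp add: mem_link)
    moreover have "\<phi> (2 * i + 1) \<in> \<phi> ` link i" by (simp add: mem_link)
    moreover have "j = i" if "2 * i \<in> link j" "\<phi> (2 * i + 1) \<in> link j" for j
      using that new(1) unfolding mem_link by linarith
    ultimately have img: "\<phi> ` link i = link i"
      using edge_cases[OF e] new(2) by metis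
    have two: "{\<phi> (2 * i + 1), \<phi> (2 * i + 2)} = {2 * i + 1, 2 * i + 2}"
    proof -
      have rest: "link i - {2 * i} = {2 * i + 1, 2 * i + 2}" by (auto simp: mem_link)
      have "\<phi> ` (link i - {2 * i}) = \<phi> ` link i - \<phi> ` {2 * i}"
        by (rule inj_on_image_set_diff[OF inj]) (use i in \<open>auto simp: mem_link\<close>)
      also have "\<dots> = link i - {2 * i}" using img IH[of "2 * i"] by simp
      finally show ?thesis by (simp add: rest)
    qed
    (* If 2i+2 went to 2i+1, then both link i and link (i + 1) would be mapped to link i, the only
       edge on 2i+1. *)
    have "\<phi> (2 * i + 2) \<noteq> 2 * i + 1"
    proof
      assume "\<phi> (2 * i + 2) = 2 * i + 1"
      then have "2 * i + 1 \<in> \<phi> ` link (Suc i)"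
        using mem_image[OF _ e', of "2 * i + 2"] i by (simp add: mem_link)
      moreover have "2 * i + 1 \<notin> chord m" using i by (auto simp: mem_chord)
      moreover have "j = i" if "2 * i + 1 \<in> link j" for j
        using that unfolding mem_link by linarith
      ultimately have "\<phi> ` link (Suc i) = link i"
        using edge_cases[OF e'] by metis
      then have "link (Suc i) = link i" using inj_edges[OF e' e] img by simp
      then show False using mem_link[of "2 * i" i] mem_link[of "2 * i" "Suc i"] by simp
    qed
    then have "\<phi> (2 * i + 1) = 2 * i + 1" "\<phi> (2 * i + 2) = 2 * i + 2"
      using two by (auto simp: doubleton_eq_iff)
    then show ?case using IH by (auto simp: le_Suc_eq)
  qed

  have fix_c: "\<phi> (2 * m + 2) = 2 * m + 2"
  proof -
    have "\<phi> (2 * m + 2) \<le> 2 * m + 2"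
      using automorphism_bij[OF aut] by (auto simp: bij_betw_def)
    moreover have "\<phi> (2 * m + 2) \<noteq> x" if "x \<le> 2 * m + 1" for x
      using along[of m] fix_d inj'[of "2 * m + 2" x] that by (cases "x = 2 * m + 1") auto
    ultimately show ?thesis by (metis Suc_eq_plus1 add_2_eq_Suc' le_Suc_eq)
  qed
  show "\<forall>x \<in> verts (chorded_path m). \<phi> x = x"
  proof
    fix x assume "x \<in> verts (chorded_path m)"
    then consider "x \<le> 2 * m" | "x = 2 * m + 1" | "x = 2 * m + 2" by force
    then show "\<phi> x = x" using along[of m] fix_d fix_c by cases auto
  qed
qed

lemma induced_link_twins:
  assumes X: "X \<subseteq> verts (chorded_path m)" and i: "i \<le> m" "link i \<subseteq> X"
    and u: "u \<in> link i" "w \<in> link i" "u \<noteq> w"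
    and others: "\<And>j. j \<le> m \<Longrightarrow> j \<noteq> i \<Longrightarrow> link j \<subseteq> X \<Longrightarrow> u \<in> link j \<longleftrightarrow> w \<in> link j"
    and chord: "chord m \<subseteq> X \<Longrightarrow> u \<in> chord m \<longleftrightarrow> w \<in> chord m"
  shows "symmetric k (induced (chorded_path m) X)"
proof (rule twins_symmetric)
  show "u \<in> verts (induced (chorded_path m) X)" "w \<in> verts (induced (chorded_path m) X)"
    using u i by auto
  fix M assume "M \<in> edges (induced (chorded_path m) X)"
  then show "u \<in> M \<longleftrightarrow> w \<in> M"
    using u others chord by (auto simp: edges_induced edges_chorded_path)
qed fact

text \<open>
  Without the chord, the first two vertices of the first surviving path edge lie on no other
  surviving edge.
\<close>

lemma induced_symmetric_if_no_chord:
  assumes X: "X \<subseteq> verts (chorded_path m)" "1 < card X" and no_chord: "\<not> chord m \<subseteq> X"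
  shows "symmetric k (induced (chorded_path m) X)"
proof (cases "\<exists>i\<le>m. link i \<subseteq> X")
  case False
  then show ?thesis
    using X no_chord by (intro edgeless_symmetric) (auto simp: edges_induced edges_chorded_path)
next
  case True
  define i where "i = (LEAST i. i \<le> m \<and> link i \<subseteq> X)"
  have i: "i \<le> m" "link i \<subseteq> X" using True unfolding i_def by (metis (mono_tags, lifting) LeastI)+
  have least: "i \<le> j" if "j \<le> m" "link j \<subseteq> X" for j
    using that unfolding i_def by (simp add: Least_le)
  show ?thesis
  proof (rule induced_link_twins[OF X(1) i, of "2 * i" "2 * i + 1"])
    fix j assume "j \<le> m" "j \<noteq> i" "link j \<subseteq> X"
    with least[of j] show "2 * i \<in> link j \<longleftrightarrow> 2 * i + 1 \<in> link j" by (auto simp: mem_link)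
  qed (use no_chord in \<open>auto simp: mem_link\<close>)
qed

text \<open>
  Among \<open>link 0, \<dots>, link (m - 1)\<close> some edge is missing. If all of them are, then \<open>2m\<close> and \<open>2m+1\<close>
  are twins. Otherwise a surviving edge is adjacent to a missing one, and in the surviving edge the
  middle vertex and the vertex shared with the missing edge are twins. The shared vertex is an inner
  vertex of the path before \<open>2m\<close>, so it does not lie on the chord.
\<close>

lemma induced_symmetric_if_broken:
  assumes m: "2 \<le> m" and X: "X \<subseteq> verts (chorded_path m)"
    and chord: "chord m \<subseteq> X" and broken: "\<exists>i<m. \<not> link i \<subseteq> X"
  shows "symmetric k (induced (chorded_path m) X)"
proof (cases "\<exists>i<m. link i \<subseteq> X")
  case False
  show ?thesis
  proof (rule twins_symmetric[of "2 * m" _ "2 * m + 1"])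
    fix M assume "M \<in> edges (induced (chorded_path m) X)"
    then have "M = chord m \<or> M = link m"
      using False by (auto simp: edges_induced edges_chorded_path nat_less_le)
    then show "2 * m \<in> M \<longleftrightarrow> 2 * m + 1 \<in> M" by (auto simp: mem_link mem_chord)
  qed (use chord in \<open>auto simp: mem_chord subset_iff\<close>)
next
  case True
  then obtain p where p: "p < m" "link p \<subseteq> X" by blast
  obtain q where q: "q < m" "\<not> link q \<subseteq> X" using broken by blast
  have "(\<exists>i. Suc i < m \<and> link i \<subseteq> X \<and> \<not> link (Suc i) \<subseteq> X)
      \<or> (\<exists>i. Suc i < m \<and> \<not> link i \<subseteq> X \<and> link (Suc i) \<subseteq> X)"
  proof (rule ccontr)
    assume "\<not> ?thesis"
    then have "i < m \<Longrightarrow> link i \<subseteq> X \<longleftrightarrow> link 0 \<subseteq> X" for i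
      by (induction i) (auto dest: Suc_lessD)
    with p q show False by blast
  qed
  then show ?thesis
  proof (elim disjE exE conjE)
    fix i assume i: "Suc i < m" "link i \<subseteq> X" "\<not> link (Suc i) \<subseteq> X"
    show ?thesis
    proof (rule induced_link_twins[OF X _ i(2), of "2 * i + 1" "2 * i + 2"])
      fix j assume "j \<noteq> i" "link j \<subseteq> X"
      with i have "j \<noteq> Suc i" by auto
      with \<open>j \<noteq> i\<close> show "2 * i + 1 \<in> link j \<longleftrightarrow> 2 * i + 2 \<in> link j" by (auto simp: mem_link)
    qed (use i in \<open>auto simp: mem_link mem_chord\<close>)
  next
    fix i assume i: "Suc i < m" "\<not> link i \<subseteq> X" "link (Suc i) \<subseteq> X"
    show ?thesis
    proof (rule induced_link_twins[OF X _ i(3), of "2 * i + 2" "2 * i + 3"])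
      fix j assume "j \<noteq> Suc i" "link j \<subseteq> X"
      with i have "j \<noteq> i" by auto
      with \<open>j \<noteq> Suc i\<close> show "2 * i + 2 \<in> link j \<longleftrightarrow> 2 * i + 3 \<in> link j" by (auto simp: mem_link)
    qed (use i in \<open>auto simp: mem_link mem_chord\<close>)
  qed
qed

text \<open>
  Without \<open>2m+2\<close> there remains a loose cycle formed by \<open>link 0, \<dots>, link (m - 1)\<close> and the chord. It
  is reversed by the reflection that exchanges the two ends \<open>0\<close> and \<open>2m\<close> of the path and fixes the
  middle vertex \<open>2m+1\<close> of the chord.
\<close>

lemma induced_symmetric_without_end:
  assumes m: "2 \<le> m"
  shows "symmetric 3 (induced (chorded_path m) {..2 * m + 1})"
proof (rule symmetricI)
  define \<rho> where "\<rho> x = (if x \<le> 2 * m then 2 * m - x else x)" for x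
  let ?G = "induced (chorded_path m) {..2 * m + 1}"
  have inv: "\<rho> (\<rho> x) = x" for x by (auto simp: \<rho>_def)
  have le: "\<rho> x \<le> 2 * m + 1 \<longleftrightarrow> x \<le> 2 * m + 1" for x by (auto simp: \<rho>_def)
  have edges: "edges ?G = insert (chord m) (link ` {..<m})"
  proof -
    have "chord m \<subseteq> {..2 * m + 1}" by (simp add: chord_def)
    moreover have "link i \<subseteq> {..2 * m + 1} \<longleftrightarrow> i < m" for i by (auto simp: link_def)
    ultimately show ?thesis by (auto simp: edges_induced edges_chorded_path)
  qed
  have img: "\<rho> ` M \<in> edges ?G" if "M \<in> edges ?G" for M
  proof -
    have "\<rho> ` chord m = chord m" by (auto simp: chord_def \<rho>_def)
    moreover have "\<rho> ` link i \<in> link ` {..<m}" if i: "i < m" for i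
    proof -
      obtain j where "m = i + j + 1" using i by (metis Suc_eq_plus1 add_Suc_right less_iff_Suc_add)
      then have "\<rho> ` link i = link j" "j < m" by (auto simp: link_eq \<rho>_def)
      then show ?thesis by simp
    qed
    ultimately show ?thesis using that unfolding edges by auto
  qed
  show "automorphism 3 ?G \<rho>"
  proof (rule automorphismI)
    show "bij_betw \<rho> (verts ?G) (verts ?G)"
      by (rule bij_betw_byWitness[of _ \<rho>]) (use inv le in auto)
    fix A
    have "\<rho> ` \<rho> ` A = A" by (simp add: image_image inv)
    then show "A \<in> edges ?G \<longleftrightarrow> \<rho> ` A \<in> edges ?G" using img by metis
  qed
  show "0 \<in> verts ?G" "\<rho> 0 \<noteq> 0" using m by (auto simp: \<rho>_def)
qed

lemma minimal_asymmetric_chorded_path: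
  assumes m: "2 \<le> m"
  shows "minimal_asymmetric 3 (chorded_path m)"
  unfolding minimal_asymmetric_def
proof (intro conjI allI impI)
  show "asymmetric 3 (chorded_path m)" by (rule asymmetric_chorded_path[OF m])
  fix X
  assume "X \<subseteq> verts (chorded_path m) \<and> 1 < card X \<and> card X < card (verts (chorded_path m))"
  then have X: "X \<subseteq> verts (chorded_path m)" "1 < card X" "X \<noteq> {..2 * m + 2}" by auto
  consider "\<not> chord m \<subseteq> X" | "chord m \<subseteq> X" "\<exists>i<m. \<not> link i \<subseteq> X"
    | "chord m \<subseteq> X" "\<forall>i<m. link i \<subseteq> X" by blast
  then show "symmetric 3 (induced (chorded_path m) X)"
  proof cases
    case 1
    then show ?thesis by (rule induced_symmetric_if_no_chord[OF X(1,2)])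
  next
    case 2
    then show ?thesis by (rule induced_symmetric_if_broken[OF m X(1)])
  next
    case 3
    have "x \<in> X" if "x \<le> 2 * m + 1" for x
    proof (cases "x < 2 * m")
      case True
      then have "x div 2 < m" "x \<in> link (x div 2)" by (auto simp: mem_link)
      then show ?thesis using 3 by blast
    next
      case False
      then have "x \<in> chord m" using that by (auto simp: mem_chord)
      then show ?thesis using 3 by blast
    qed
    then have lower: "{..2 * m + 1} \<subseteq> X" by blast
    have whole: "verts (chorded_path m) = insert (2 * m + 2) {..2 * m + 1}" by auto
    then have "2 * m + 2 \<notin> X" using lower X by auto
    then have "X = {..2 * m + 1}" using lower X(1) unfolding whole by blast
    then show ?thesis using induced_symmetric_without_end[OF m] by simp
  qed
qed

section \<open>Every uniformity\<close>

lemma minimal_asymmetric_exists: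
  assumes "2 \<le> m"
  shows "\<exists>G :: nat hypergraph. kgraph (3 + d) G \<and> verts G = {..<2 * m + 3 + d} \<and>
    (\<forall>w \<in> verts G. \<exists>M \<in> edges G. w \<notin> M) \<and> minimal_asymmetric (3 + d) G"
proof (induction d)
  case 0
  have "verts (chorded_path m) = {..<2 * m + 3 + 0}" by auto
  then show ?case
    using assms kgraph_chorded_path[of m] chorded_path_no_common_vertex[of m]
      minimal_asymmetric_chorded_path[of m] by (intro exI[of _ "chorded_path m"]) simp
next
  case (Suc d)
  then obtain G :: "nat hypergraph" where G: "kgraph (3 + d) G" "verts G = {..<2 * m + 3 + d}"
    "\<forall>w \<in> verts G. \<exists>M \<in> edges G. w \<notin> M" "minimal_asymmetric (3 + d) G" by blast
  show ?case
    by (rule raise_uniformity[OF G(1,2) _ _ G(3,4)]) (use assms in auto)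
qed

theorem theorem3:
  fixes k :: nat
  assumes "k \<ge> 3"
  shows "\<exists>\<G> :: nat hypergraph set.
           infinite \<G> \<and>
           (\<forall>G \<in> \<G>. kgraph k G \<and> minimal_asymmetric k G) \<and>
           pairwise (\<lambda>G H. \<not> isomorphic k G H) \<G>"
proof -
  have "\<exists>G :: nat hypergraph. kgraph k G \<and> minimal_asymmetric k G \<and> card (verts G) = 2 * m + 4 + k"
    for m
  proof -
    have params: "3 + (k - 3) = k" "2 * (m + 2) + 3 + (k - 3) = 2 * m + 4 + k"
      using assms by simp_all
    have "2 \<le> m + 2" by simp
    from minimal_asymmetric_exists[OF this, of "k - 3", unfolded params]
    obtain G :: "nat hypergraph" where
      "kgraph k G" "minimal_asymmetric k G" "verts G = {..<2 * m + 4 + k}" by blast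
    moreover from this have "card (verts G) = 2 * m + 4 + k" by simp
    ultimately show ?thesis by blast
  qed
  then obtain F :: "nat \<Rightarrow> nat hypergraph" where
    F: "\<And>m. kgraph k (F m)" "\<And>m. minimal_asymmetric k (F m)"
      "\<And>m. card (verts (F m)) = 2 * m + 4 + k" by metis
  have iso: "m = n" if mn: "isomorphic k (F m) (F n)" for m n
  proof -
    obtain \<phi> where "bij_betw \<phi> (verts (F m)) (verts (F n))"
      using mn unfolding isomorphic_def isomorphism_def by blast
    then have "card (verts (F m)) = card (verts (F n))" by (rule bij_betw_same_card)
    then show ?thesis unfolding F(3) by simp
  qed
  have "inj F"
  proof (rule injI)
    fix m n assume "F m = F n"
    then have "card (verts (F m)) = card (verts (F n))" by simp
    then show "m = n" unfolding F(3) by simp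
  qed
  then have "infinite (range F)" by (simp add: finite_image_iff)
  moreover have "pairwise (\<lambda>G H. \<not> isomorphic k G H) (range F)"
    using iso unfolding pairwise_def by blast
  ultimately show ?thesis using F(1,2) by blast
qed

end
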